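(* Let $n>1$ be an integer and let $f\in\mathcal{R}$ be an eigenfunction of $U_n$ with eigenvalue $\lambda\neq 0$ (that is, $f\neq 0$ and $U_n f=\lambda f$). Then all the poles of $f$ have the same multiplicity.
   Context: $\mathcal{R}$ is the complex vector space of rational functions $p(x)/q(x)$, $p,q\in\mathbb{C}[x]$, that are analytic at the origin; each is identified with its Taylor series $\sum_{k\ge 0}a(k)x^k$ at $0$. For a positive integer $n$, the operator $U_n:\mathcal{R}\to\mathcal{R}$ is the linear operator $U_n\left(\sum_{k\ge 0}a(k)x^k\right)=\sum_{k\ge 0}a(nk)x^k$ (it is known that $U_n$ maps $\mathcal{R}$ to $\mathcal{R}$). Poles are poles in $\mathbb{C}$, and the multiplicity of a pole is its order. *)

theory Defs
  imports "HOL-Complex_Analysis.Complex_Analysis"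
begin

text \<open>
  Division by zero yields zero, so a rational function has a junk value at the zeros of
  the chosen denominator, even at removable ones.  Poles and their orders do not depend
  on these values.
\<close>

definition rational_function :: "(complex \<Rightarrow> complex) \<Rightarrow> bool" where
  "rational_function f \<longleftrightarrow> (\<exists>p q. q \<noteq> 0 \<and> f = (\<lambda>z. poly p z / poly q z))"

text \<open>
  \<open>f has_fps_expansion F\<close> says that \<open>f\<close> is analytic at the origin with Taylor series \<open>F\<close>.
  A rational function whose singularity at the origin is removable satisfies this once it
  is written in lowest terms.
\<close>

definition represents :: "(complex \<Rightarrow> complex) \<Rightarrow> complex fps \<Rightarrow> bool" where
  "represents f F \<longleftrightarrow> rational_function f \<and> f has_fps_expansion F"

text \<open>
  The space of rational functions analytic at the origin, each identified with its Taylor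
  series there.
\<close>

definition rational_series :: "complex fps set" where
  "rational_series = {F. \<exists>f. represents f F}"

definition U :: "nat \<Rightarrow> complex fps \<Rightarrow> complex fps" where
  "U n F = Abs_fps (\<lambda>k. fps_nth F (n * k))"

definition eigenfunction :: "nat \<Rightarrow> complex \<Rightarrow> complex fps \<Rightarrow> bool" where
  "eigenfunction n \<mu> F \<longleftrightarrow> F \<in> rational_series \<and> F \<noteq> 0 \<and> U n F = fps_const \<mu> * F"

text \<open>The order of a pole; meaningful only if \<open>is_pole f z\<close>, where \<open>zorder f z < 0\<close>.\<close>

definition pole_multiplicity :: "(complex \<Rightarrow> complex) \<Rightarrow> complex \<Rightarrow> nat" where
  "pole_multiplicity f z = nat (- zorder f z)"

end

theory Submission
  imports Defs
begin

text \<open>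
  Averaging a power series over the rotations by the \<open>n\<close>-th roots of unity keeps exactly the
  coefficients whose index is divisible by \<open>n\<close>.  So \<open>U n F = \<mu> F\<close> says that
  \<open>(\<Sum>\<zeta> | \<zeta> ^ n = 1. f (\<zeta> * x)) = n * \<mu> * f (x ^ n)\<close>,
  first near the origin and then, by analytic continuation, off a finite set
  (\<open>root_average_near_0\<close>, \<open>root_average_everywhere\<close>).

  Let \<open>P\<close> be the finite set of poles of \<open>f\<close>.  If \<open>x ^ n\<close> is a pole, the right-hand side blows
  up at \<open>x\<close>, hence so does some summand on the left, and \<open>x ^ n\<close> is the \<open>n\<close>-th power of the
  pole \<open>\<zeta> x\<close>.  Thus \<open>P\<close> lies in its own image under \<open>z \<mapsto> z ^ n\<close>, and finiteness makes this
  map a permutation of \<open>P\<close> (\<open>power_bij_poles\<close>).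

  By injectivity, at a pole \<open>x\<close> only the summand \<open>\<zeta> = 1\<close> is singular, so no cancellation
  occurs.  Let \<open>x\<close> have order \<open>d\<close> and leading Laurent coefficient \<open>l x\<close>.  Since
  \<open>y ^ n - x ^ n\<close> behaves like \<open>n x ^ (n - 1) (y - x)\<close> near \<open>x\<close>, comparing both sides shows that
  \<open>x ^ n\<close> also has order \<open>d\<close> and that \<open>n \<mu> l (x ^ n) = (n x ^ (n - 1)) ^ d l x\<close>
  (\<open>leading_coeff_power_pole\<close>).

  Now multiply the absolute values of this equation over all poles of order \<open>d\<close>.  The power map
  permutes these poles, so the coefficients \<open>l\<close> cancel, and the product of the \<open>x ^ (n - 1)\<close>
  has absolute value 1.  What remains is \<open>n |\<mu>| = n ^ d\<close> (\<open>pole_order_determined\<close>).  For \<open>n > 1\<close>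
  this determines \<open>d\<close> from \<open>\<mu>\<close>, so all poles have the same order.
\<close>

section \<open>Averaging over the roots of unity\<close>

text \<open>
  Multiplication by the primitive root \<open>\<omega>\<close> permutes the roots of unity and multiplies the sum
  by \<open>\<omega> ^ k\<close>; unless \<open>n\<close> divides \<open>k\<close> this factor differs from 1, which forces the sum to vanish.
\<close>

lemma sum_power_roots_unity:
  assumes "n > 0"
  shows "(\<Sum>\<zeta> | \<zeta> ^ n = 1. \<zeta> ^ k) = (if n dvd k then of_nat n else (0::complex))"
proof (cases "n dvd k")
  case True
  then obtain m where "k = n * m" by blast
  then have "(\<Sum>\<zeta> | \<zeta> ^ n = 1. \<zeta> ^ k :: complex) = (\<Sum>\<zeta> | (\<zeta>::complex) ^ n = 1. 1)"
    by (auto intro!: sum.cong simp: power_mult)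
  with True assms show ?thesis by (simp add: card_roots_unity_eq)
next
  case False
  define \<omega> where "\<omega> = cis (2 * pi / real n)"
  define s where "s = (\<Sum>\<zeta> | \<zeta> ^ n = 1. \<zeta> ^ k :: complex)"
  have \<omega>: "\<omega> ^ n = 1" unfolding \<omega>_def Complex.DeMoivre using assms by simp
  have "\<omega> ^ k \<noteq> 1"
  proof
    assume "\<omega> ^ k = 1"
    then have "cis (2 * pi * (real k / real n)) = 1"
      unfolding \<omega>_def Complex.DeMoivre by (simp add: mult_ac)
    then have "cos (2 * pi * (real k / real n)) = 1"
      by (simp add: complex_eq_iff)
    then obtain j :: int where "2 * pi * (real k / real n) = of_int j * 2 * pi"
      by (auto simp: cos_one_2pi_int)
    then have "real k = of_int j * real n"
      using assms by (simp add: field_simps)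
    then have "int k = j * int n"
      by (metis of_int_eq_iff of_int_mult of_int_of_nat_eq)
    with False show False
      by (metis dvd_triv_right int_dvd_int_iff)
  qed
  have "\<omega> \<noteq> 0" by (simp add: \<omega>_def)
  have "s = (\<Sum>\<zeta> | \<zeta> ^ n = 1. (\<omega> * \<zeta>) ^ k)"
    unfolding s_def
    by (rule sum.reindex_bij_witness[of _ "\<lambda>\<zeta>. \<omega> * \<zeta>" "\<lambda>\<zeta>. \<zeta> / \<omega>"])
       (use \<omega> \<open>\<omega> \<noteq> 0\<close> in \<open>auto simp: power_mult_distrib power_divide\<close>)
  also have "\<dots> = \<omega> ^ k * s"
    by (simp add: s_def power_mult_distrib sum_distrib_left)
  finally have "s = 0" using \<open>\<omega> ^ k \<noteq> 1\<close> by simp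
  with False show ?thesis by (simp add: s_def)
qed

text \<open>
  The eigenvalue equation relates coefficients only.  Comparing Taylor series turns it into an
  equation between functions.
\<close>

lemma root_average_near_0:
  assumes "n > 0" and f: "f has_fps_expansion F" and U: "U n F = fps_const \<mu> * F"
  shows "\<forall>\<^sub>F x in nhds 0. (\<Sum>\<zeta> | \<zeta> ^ n = 1. f (\<zeta> * x)) = of_nat n * \<mu> * f (x ^ n)"
proof -
  define G where "G = (\<Sum>\<zeta> | \<zeta> ^ n = 1. F oo (fps_const \<zeta> * fps_X))"
  define H where "H = fps_const (of_nat n * \<mu>) * (F oo fps_X ^ n)"
  have 1: "(\<lambda>x. \<Sum>\<zeta> | \<zeta> ^ n = 1. f (\<zeta> * x)) has_fps_expansion G"
    unfolding G_def
    by (intro has_fps_expansion_sum has_fps_expansion_compose[OF f, unfolded o_def]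
          has_fps_expansion_cmult_left has_fps_expansion_fps_X) simp
  have 2: "(\<lambda>x. of_nat n * \<mu> * f (x ^ n)) has_fps_expansion H"
    unfolding H_def using \<open>n > 0\<close>
    by (intro has_fps_expansion_cmult_left has_fps_expansion_compose[OF f, unfolded o_def]
          has_fps_expansion_power has_fps_expansion_fps_X) simp
  have "fps_nth F (n * k) = \<mu> * fps_nth F k" for k
    using arg_cong[OF U, of "\<lambda>A. fps_nth A k"] by (simp add: U_def)
  then have "G = H"
    using \<open>n > 0\<close>
    by (auto simp: fps_eq_iff G_def H_def fps_sum_nth fps_nth_compose_X_power
        sum_power_roots_unity simp flip: sum_distrib_right)
  with 1 2 have "\<forall>\<^sub>F x in nhds 0. eval_fps G x = (\<Sum>\<zeta> | \<zeta> ^ n = 1. f (\<zeta> * x))"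
      "\<forall>\<^sub>F x in nhds 0. eval_fps G x = of_nat n * \<mu> * f (x ^ n)"
    by (simp_all add: has_fps_expansion_def)
  then show ?thesis by eventually_elim simp
qed

text \<open>
  Both sides are holomorphic off the finite set of points that rotation or the power map can
  send into \<open>Q\<close>, and the complement of a finite set is connected, so the identity theorem
  applies.  The values of \<open>f\<close> on \<open>Q\<close> are arbitrary; the conclusion is phrased with punctured
  neighbourhoods because small ones avoid all exceptional points.
\<close>

lemma root_average_everywhere:
  assumes "n > 0" and "finite Q" and f: "f holomorphic_on - Q"
    and near_0: "\<forall>\<^sub>F x in nhds 0. (\<Sum>\<zeta> | \<zeta> ^ n = 1. f (\<zeta> * x)) = c * f (x ^ n)"
  shows "\<forall>\<^sub>F x in at a. (\<Sum>\<zeta> | \<zeta> ^ n = 1. f (\<zeta> * x)) = c * f (x ^ n)"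
proof -
  \<comment> \<open>The second part collects the points \<open>x\<close> for which some \<open>\<zeta> * x\<close> lies in \<open>Q\<close>.\<close>
  define S where "S = (\<lambda>x::complex. x ^ n) -` (Q \<union> (\<lambda>y. y ^ n) ` Q)"
  have "S = (\<Union>w \<in> Q \<union> (\<lambda>y. y ^ n) ` Q. {x. x ^ n = w})"
    by (auto simp: S_def)
  then have "finite S"
    using \<open>finite Q\<close> \<open>n > 0\<close> by (simp add: finite_nth_roots)
  have op: "open (- S)" using \<open>finite S\<close> by (simp add: finite_imp_closed open_Compl)
  obtain B where B: "open B" "0 \<in> B"
      "\<And>x. x \<in> B \<Longrightarrow> (\<Sum>\<zeta> | \<zeta> ^ n = 1. f (\<zeta> * x)) = c * f (x ^ n)"
    using near_0 unfolding eventually_nhds by blast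
  have "infinite B" using B(1,2) by (metis emptyE finite_imp_not_open)
  have notQ: "\<zeta> * x \<notin> Q" if "x \<notin> S" "\<zeta> ^ n = 1" for \<zeta> x
  proof
    assume "\<zeta> * x \<in> Q"
    then have "(\<zeta> * x) ^ n \<in> (\<lambda>y. y ^ n) ` Q" by blast
    with that show False by (simp add: S_def power_mult_distrib)
  qed
  have "(\<Sum>\<zeta> | \<zeta> ^ n = 1. f (\<zeta> * x)) = c * f (x ^ n)" if "x \<in> - S" for x
  proof (rule analytic_continuation_open[of "B - S" "- S" _ _ x])
    show "open (B - S)" using B op by (simp add: Diff_eq open_Int)
    show "B - S \<noteq> {}" using \<open>infinite B\<close> \<open>finite S\<close> by (metis Diff_eq_empty_iff finite_subset)
    show "connected (- S)"
      using connected_open_delete_finite[of "UNIV :: complex set" S] \<open>finite S\<close>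
      by (simp add: Compl_eq_Diff_UNIV connected_UNIV)
    show "(\<lambda>x. \<Sum>\<zeta> | \<zeta> ^ n = 1. f (\<zeta> * x)) holomorphic_on - S"
      by (intro holomorphic_on_sum holomorphic_on_compose_gen[OF _ f, unfolded o_def])
         (auto intro!: holomorphic_intros simp: notQ)
    show "(\<lambda>x. c * f (x ^ n)) holomorphic_on - S"
      by (intro holomorphic_on_mult holomorphic_on_const
            holomorphic_on_compose_gen[OF _ f, unfolded o_def])
         (auto intro!: holomorphic_intros simp: S_def)
  qed (use op that B(3) in auto)
  moreover have "\<forall>\<^sub>F x in at a. x \<notin> S"
    using islimpt_finite[OF \<open>finite S\<close>, of a] by (simp add: islimpt_iff_eventually)
  ultimately show ?thesis by (auto elim: eventually_mono)
qed

section \<open>Leading coefficients at poles\<close>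

text \<open>
  For meromorphic \<open>f\<close> and \<open>d > 0\<close> this says that \<open>f\<close> has a pole of order \<open>d\<close> at \<open>z\<close> whose Laurent expansion starts
  with \<open>c\<close>.  As a limit it can be computed term by term in a sum and does not depend on the
  value of \<open>f\<close> at \<open>z\<close>.
\<close>

definition has_leading_coeff :: "(complex \<Rightarrow> complex) \<Rightarrow> complex \<Rightarrow> nat \<Rightarrow> complex \<Rightarrow> bool" where
  "has_leading_coeff f z d c \<longleftrightarrow> c \<noteq> 0 \<and> ((\<lambda>y. (y - z) ^ d * f y) \<longlongrightarrow> c) (at z)"

lemma pole_has_leading_coeff:
  assumes mero: "f meromorphic_on {z}" and pole: "is_pole f z"
  shows "pole_multiplicity f z > 0"
    and "\<exists>c. has_leading_coeff f z (pole_multiplicity f z) c"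
proof -
  obtain r where "r > 0" "f analytic_on ball z r - {z}"
    using mero by (auto simp: meromorphic_at_iff isolated_singularity_at_def)
  then have "f holomorphic_on ball z r - {z}" by (simp add: analytic_imp_holomorphic)
  from zorder_exist_pole[OF this _ _ pole] \<open>r > 0\<close> obtain s where
    ord: "zorder f z < 0" and nz: "zor_poly f z z \<noteq> 0" and "s > 0"
    and holo: "zor_poly f z holomorphic_on cball z s"
    and eq: "\<And>w. w \<in> cball z s - {z} \<Longrightarrow>
          f w = zor_poly f z w / (w - z) ^ nat (- zorder f z)"
    by auto
  from ord show "pole_multiplicity f z > 0" by (simp add: pole_multiplicity_def)
  have "isCont (zor_poly f z) z"
    using holo \<open>s > 0\<close> by (meson ball_subset_cball centre_in_ball continuous_on_eq_continuous_at
        holomorphic_on_imp_continuous_on holomorphic_on_subset open_ball)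
  then have "(zor_poly f z \<longlongrightarrow> zor_poly f z z) (at z)" by (simp add: isCont_def)
  moreover have "\<forall>\<^sub>F y in at z. (y - z) ^ pole_multiplicity f z * f y = zor_poly f z y"
    using eventually_at_in_open[of "ball z s" z] \<open>s > 0\<close>
    by (auto simp: pole_multiplicity_def eq elim!: eventually_mono)
  ultimately have "((\<lambda>y. (y - z) ^ pole_multiplicity f z * f y) \<longlongrightarrow> zor_poly f z z) (at z)"
    by (simp add: filterlim_cong)
  with nz show "\<exists>c. has_leading_coeff f z (pole_multiplicity f z) c"
    unfolding has_leading_coeff_def by blast
qed

lemma has_leading_coeff_unique:
  assumes 1: "has_leading_coeff f z d c" and 2: "has_leading_coeff f z e b"
  shows "d = e \<and> c = b"
proof -
  have le: "e \<le> d" if 1: "has_leading_coeff f z d c" and 2: "has_leading_coeff f z e b"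
    for d e c b
  proof (rule ccontr)
    assume "\<not> e \<le> d"
    then have "((\<lambda>y. (y - z) ^ (e - d) * ((y - z) ^ d * f y)) \<longlongrightarrow> (z - z) ^ (e - d) * c) (at z)"
      using 1 by (intro tendsto_intros) (auto simp: has_leading_coeff_def)
    then have "((\<lambda>y. (y - z) ^ e * f y) \<longlongrightarrow> 0) (at z)"
      using \<open>\<not> e \<le> d\<close> by (simp add: power_0_left flip: mult.assoc power_add)
    with 2 show False
      using tendsto_unique[of "at z"] by (auto simp: has_leading_coeff_def)
  qed
  have "d = e" using le[OF 1 2] le[OF 2 1] by simp
  with 1 2 show ?thesis
    using tendsto_unique[of "at z"] by (auto simp: has_leading_coeff_def)
qed

lemma filterlim_power_at:
  fixes z :: complex
  assumes "n > 0"
  shows "filterlim (\<lambda>y. y ^ n) (at (z ^ n)) (at z)"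
proof -
  have "\<forall>\<^sub>F y in at z. y ^ n \<noteq> z ^ n"
    using islimpt_finite[OF finite_nth_roots[OF assms, of "z ^ n"], of z]
    by (simp add: islimpt_iff_eventually)
  then show ?thesis by (auto simp: filterlim_at intro!: tendsto_intros)
qed

text \<open>
  The power map is a local bijection away from 0, so pulling back along it preserves the order.
  The coefficient is divided by the \<open>d\<close>-th power of the derivative, since \<open>y ^ n - z ^ n\<close> is
  asymptotic to that derivative times \<open>y - z\<close>.
\<close>

lemma has_leading_coeff_power:
  assumes "n > 0" and "z \<noteq> 0" and lead: "has_leading_coeff f (z ^ n) d c"
  shows "has_leading_coeff (\<lambda>y. f (y ^ n)) z d (c / (of_nat n * z ^ (n - 1)) ^ d)"
proof -
  define D where "D = of_nat n * z ^ (n - 1)"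
  have "D \<noteq> 0" using assms by (simp add: D_def)
  have lim: "filterlim (\<lambda>y. y ^ n) (at (z ^ n)) (at z)"
    by (rule filterlim_power_at) fact
  have "((\<lambda>y. y ^ n) has_field_derivative D) (at z)"
    unfolding D_def by (auto intro!: derivative_eq_intros)
  then have "((\<lambda>y. (y ^ n - z ^ n) / (y - z)) \<longlongrightarrow> D) (at z)"
    by (simp add: has_field_derivative_iff)
  moreover have "((\<lambda>y. (y ^ n - z ^ n) ^ d * f (y ^ n)) \<longlongrightarrow> c) (at z)"
    using lead filterlim_compose[OF _ lim] by (auto simp: has_leading_coeff_def)
  ultimately have "((\<lambda>y. (y ^ n - z ^ n) ^ d * f (y ^ n) / ((y ^ n - z ^ n) / (y - z)) ^ d)
      \<longlongrightarrow> c / D ^ d) (at z)"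
    using \<open>D \<noteq> 0\<close> by (intro tendsto_intros) auto
  moreover have "\<forall>\<^sub>F y in at z. (y ^ n - z ^ n) ^ d * f (y ^ n) / ((y ^ n - z ^ n) / (y - z)) ^ d
      = (y - z) ^ d * f (y ^ n)"
    using lim by (auto simp: filterlim_at power_divide elim!: eventually_mono)
  ultimately have "((\<lambda>y. (y - z) ^ d * f (y ^ n)) \<longlongrightarrow> c / D ^ d) (at z)"
    by (simp add: filterlim_cong)
  then show ?thesis
    using lead \<open>D \<noteq> 0\<close> unfolding has_leading_coeff_def D_def[symmetric] by simp
qed

section \<open>The power map on the poles\<close>

lemma tendsto_rotate:
  fixes \<zeta> a :: complex
  assumes "(f \<longlongrightarrow> L) (at (\<zeta> * a))" and "\<zeta> \<noteq> 0"
  shows "((\<lambda>x. f (\<zeta> * x)) \<longlongrightarrow> L) (at a)"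
proof (rule filterlim_compose[OF assms(1)])
  show "filterlim (\<lambda>x. \<zeta> * x) (at (\<zeta> * a)) (at a)"
    using \<open>\<zeta> \<noteq> 0\<close> by (auto simp: filterlim_at eventually_at_filter intro!: tendsto_intros)
qed

lemma meromorphic_not_pole_limit:
  assumes "f meromorphic_on UNIV" and "\<not> is_pole f z"
  obtains L where "(f \<longlongrightarrow> L) (at z)"
proof -
  have "not_essential f z"
    using assms(1) by (meson meromorphic_on_not_essential meromorphic_on_subset subset_UNIV)
  with assms(2) that show thesis by (auto simp: not_essential_def)
qed

text \<open>
  Only surjectivity needs analysis: for a pole \<open>w = x ^ n\<close> the right-hand side of the averaging
  identity is unbounded at \<open>x\<close>, whereas the left-hand side would have a limit there if no
  \<open>n\<close>-th root \<open>\<zeta> * x\<close> of \<open>w\<close> were a pole.  Counting then gives the rest.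
\<close>

lemma power_bij_poles:
  assumes "n > 0" and mero: "f meromorphic_on UNIV" and "c \<noteq> 0"
    and avg: "\<And>a. \<forall>\<^sub>F x in at a. (\<Sum>\<zeta> | \<zeta> ^ n = 1. f (\<zeta> * x)) = c * f (x ^ n)"
    and fin: "finite {z. is_pole f z}"
  shows "bij_betw (\<lambda>z. z ^ n) {z. is_pole f z} {z. is_pole f z}"
proof -
  define P where "P = {z. is_pole f z}"
  have sub: "P \<subseteq> (\<lambda>z. z ^ n) ` P"
  proof
    fix w assume "w \<in> P"
    obtain x where x: "x ^ n = w" using exists_complex_root[of n w] \<open>n > 0\<close> by auto
    show "w \<in> (\<lambda>z. z ^ n) ` P"
    proof (rule ccontr)
      assume no: "w \<notin> (\<lambda>z. z ^ n) ` P"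
      have "\<exists>L. ((\<lambda>y. f (\<zeta> * y)) \<longlongrightarrow> L) (at x)" if "\<zeta> ^ n = 1" for \<zeta>
      proof -
        have "(\<zeta> * x) ^ n = w" using that x by (simp add: power_mult_distrib)
        with no have "\<not> is_pole f (\<zeta> * x)" by (auto simp: P_def)
        moreover have "\<zeta> \<noteq> 0" using that \<open>n > 0\<close> by (auto simp: power_0_left)
        ultimately show ?thesis
          using meromorphic_not_pole_limit[OF mero] tendsto_rotate by metis
      qed
      then obtain L where "\<And>\<zeta>. \<zeta> ^ n = 1 \<Longrightarrow> ((\<lambda>y. f (\<zeta> * y)) \<longlongrightarrow> L \<zeta>) (at x)"
        by metis
      then have "((\<lambda>y. \<Sum>\<zeta> | \<zeta> ^ n = 1. f (\<zeta> * y)) \<longlongrightarrow> (\<Sum>\<zeta> | \<zeta> ^ n = 1. L \<zeta>)) (at x)"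
        by (intro tendsto_sum) auto
      then have "((\<lambda>y. c * f (y ^ n)) \<longlongrightarrow> (\<Sum>\<zeta> | \<zeta> ^ n = 1. L \<zeta>)) (at x)"
        using filterlim_cong[OF refl refl avg[of x]] by blast
      from tendsto_mult_left[OF this, of "1 / c"]
      have "((\<lambda>y. f (y ^ n)) \<longlongrightarrow> 1 / c * (\<Sum>\<zeta> | \<zeta> ^ n = 1. L \<zeta>)) (at x)"
        using \<open>c \<noteq> 0\<close> by simp
      moreover have "filterlim (\<lambda>y. f (y ^ n)) at_infinity (at x)"
        using \<open>w \<in> P\<close> x filterlim_compose[OF _ filterlim_power_at[OF \<open>n > 0\<close>, of x]]
        by (auto simp: P_def is_pole_def)
      ultimately show False
        using not_tendsto_and_filterlim_at_infinity[of "at x"] by auto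
    qed
  qed
  have "finite P" using fin by (simp add: P_def)
  with sub have "P = (\<lambda>z. z ^ n) ` P"
    by (intro card_seteq) (auto intro: card_image_le)
  with \<open>finite P\<close> show ?thesis
    unfolding bij_betw_def P_def[symmetric] by (metis eq_card_imp_inj_on)
qed

text \<open>
  If \<open>x\<close> is the only pole among its rotations, then after multiplication by \<open>(y - x) ^ d\<close>
  all summands of the average but one tend to 0, so the averaging identity shows the leading
  term of \<open>f\<close> at \<open>x\<close> to be that of \<open>c * f (y ^ n)\<close>.  The latter is also known from the leading
  term at \<open>x ^ n\<close>.
\<close>

lemma leading_coeff_power_pole:
  assumes "n > 0" and mero: "f meromorphic_on UNIV" and "c \<noteq> 0"
    and avg: "\<forall>\<^sub>F y in at x. (\<Sum>\<zeta> | \<zeta> ^ n = 1. f (\<zeta> * y)) = c * f (y ^ n)"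
    and only: "\<And>\<zeta>. \<lbrakk>\<zeta> ^ n = 1; is_pole f (\<zeta> * x)\<rbrakk> \<Longrightarrow> \<zeta> = 1"
    and "x \<noteq> 0" and "d > 0" and a: "has_leading_coeff f x d a"
    and b: "has_leading_coeff f (x ^ n) e b"
  shows "e = d \<and> c * b = (of_nat n * x ^ (n - 1)) ^ d * a"
proof -
  define D where "D = of_nat n * x ^ (n - 1)"
  have "D \<noteq> 0" using assms by (simp add: D_def)
  define R where "R = {\<zeta>::complex. \<zeta> ^ n = 1}"
  have "finite R" using \<open>n > 0\<close> by (simp add: R_def finite_nth_roots)
  have lim: "((\<lambda>y. (y - x) ^ d * f (\<zeta> * y)) \<longlongrightarrow> (if \<zeta> = 1 then a else 0)) (at x)"
    if "\<zeta> \<in> R" for \<zeta>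
  proof (cases "\<zeta> = 1")
    case True
    then show ?thesis using a by (simp add: has_leading_coeff_def)
  next
    case False
    then have "\<not> is_pole f (\<zeta> * x)" using only that by (auto simp: R_def)
    moreover have "\<zeta> \<noteq> 0" using that \<open>n > 0\<close> by (auto simp: R_def power_0_left)
    ultimately obtain L where "((\<lambda>y. f (\<zeta> * y)) \<longlongrightarrow> L) (at x)"
      using meromorphic_not_pole_limit[OF mero] tendsto_rotate by metis
    then have "((\<lambda>y. (y - x) ^ d * f (\<zeta> * y)) \<longlongrightarrow> (x - x) ^ d * L) (at x)"
      by (intro tendsto_intros)
    then show ?thesis using False \<open>d > 0\<close> by (simp add: power_0_left)
  qed
  have "((\<lambda>y. \<Sum>\<zeta>\<in>R. (y - x) ^ d * f (\<zeta> * y)) \<longlongrightarrow> (\<Sum>\<zeta>\<in>R. if \<zeta> = 1 then a else 0)) (at x)"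
    by (intro tendsto_sum lim)
  then have "((\<lambda>y. (y - x) ^ d * (\<Sum>\<zeta>\<in>R. f (\<zeta> * y))) \<longlongrightarrow> a) (at x)"
    using \<open>finite R\<close> by (simp add: sum_distrib_left R_def)
  moreover have "\<forall>\<^sub>F y in at x. (y - x) ^ d * (\<Sum>\<zeta>\<in>R. f (\<zeta> * y)) = c * ((y - x) ^ d * f (y ^ n))"
    using avg by eventually_elim (simp add: R_def)
  ultimately have "((\<lambda>y. c * ((y - x) ^ d * f (y ^ n))) \<longlongrightarrow> a) (at x)"
    by (simp add: filterlim_cong)
  from tendsto_mult_left[OF this, of "1 / c"]
  have "((\<lambda>y. (y - x) ^ d * f (y ^ n)) \<longlongrightarrow> a / c) (at x)"
    using \<open>c \<noteq> 0\<close> by simp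
  then have "has_leading_coeff (\<lambda>y. f (y ^ n)) x d (a / c)"
    using a \<open>c \<noteq> 0\<close> by (simp add: has_leading_coeff_def)
  moreover have "has_leading_coeff (\<lambda>y. f (y ^ n)) x e (b / D ^ e)"
    unfolding D_def using has_leading_coeff_power b \<open>n > 0\<close> \<open>x \<noteq> 0\<close> by blast
  ultimately have "d = e" "a / c = b / D ^ e"
    using has_leading_coeff_unique by blast+
  then show ?thesis using \<open>c \<noteq> 0\<close> \<open>D \<noteq> 0\<close> unfolding D_def[symmetric] by (simp add: field_simps)
qed

text \<open>
  Along an orbit of the power map the order stays constant while the leading coefficients
  change by explicit factors.  Taking the product over all poles of the given order, rather than
  over a single orbit, removes the unknown coefficients without a description of the orbits.
\<close>

lemma pole_order_determined:
  assumes "n > 0" and mero: "f meromorphic_on UNIV" and "c \<noteq> 0"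
    and avg: "\<And>a. \<forall>\<^sub>F x in at a. (\<Sum>\<zeta> | \<zeta> ^ n = 1. f (\<zeta> * x)) = c * f (x ^ n)"
    and fin: "finite {z. is_pole f z}" and "\<not> is_pole f 0" and "is_pole f w"
  shows "norm c = real n ^ pole_multiplicity f w"
proof -
  define P where "P = {z. is_pole f z}"
  define m where "m = pole_multiplicity f"
  have bij: "bij_betw (\<lambda>z. z ^ n) P P"
    unfolding P_def by (rule power_bij_poles) fact+
  have pow_P: "z ^ n \<in> P" if "z \<in> P" for z
    using bij that by (auto simp: bij_betw_def)
  have "\<exists>c. has_leading_coeff f z (m z) c" and m_pos: "m z > 0" if "z \<in> P" for z
    using pole_has_leading_coeff[of f z] that meromorphic_on_subset[OF mero]
    by (auto simp: P_def m_def)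
  then obtain l where l: "\<And>z. z \<in> P \<Longrightarrow> has_leading_coeff f z (m z) (l z)"
    by metis
  have step: "m (z ^ n) = m z \<and> c * l (z ^ n) = (of_nat n * z ^ (n - 1)) ^ m z * l z"
    if "z \<in> P" for z
  proof (rule leading_coeff_power_pole)
    show "has_leading_coeff f z (m z) (l z)" "has_leading_coeff f (z ^ n) (m (z ^ n)) (l (z ^ n))"
      "m z > 0"
      using l m_pos pow_P that by auto
    show "z \<noteq> 0" using that \<open>\<not> is_pole f 0\<close> by (auto simp: P_def)
    show "\<zeta> = 1" if "\<zeta> ^ n = 1" "is_pole f (\<zeta> * z)" for \<zeta>
    proof -
      have "(\<zeta> * z) ^ n = z ^ n" using that by (simp add: power_mult_distrib)
      then have "\<zeta> * z = z"
        using bij that(2) \<open>z \<in> P\<close> unfolding bij_betw_def inj_on_def P_def by blast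
      with \<open>z \<noteq> 0\<close> show ?thesis by simp
    qed
  qed (use \<open>n > 0\<close> mero \<open>c \<noteq> 0\<close> avg in auto)

  define d where "d = m w"
  define E where "E = {z \<in> P. m z = d}"
  have "w \<in> E" using \<open>is_pole f w\<close> by (simp add: E_def d_def P_def)
  have "finite E" using fin by (simp add: E_def P_def)
  have "inj_on (\<lambda>z. z ^ n) E"
    using bij by (auto simp: bij_betw_def E_def intro: inj_on_subset)
  moreover have "(\<lambda>z. z ^ n) ` E \<subseteq> E"
    using step pow_P by (auto simp: E_def)
  ultimately have bij_E: "bij_betw (\<lambda>z. z ^ n) E E"
    using \<open>finite E\<close> by (simp add: bij_betw_def endo_inj_surj)

  define A where "A = (\<Prod>z\<in>E. norm z)"
  define C where "C = (\<Prod>z\<in>E. norm (l z))"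
  have "A > 0"
    unfolding A_def using \<open>\<not> is_pole f 0\<close> by (intro prod_pos) (auto simp: E_def P_def)
  have "C > 0"
    unfolding C_def using l by (intro prod_pos) (auto simp: E_def has_leading_coeff_def)
  \<comment> \<open>Permuting the poles by the power map leaves \<open>A\<close> unchanged, but it also raises \<open>A\<close> to
    the power \<open>n\<close>.\<close>
  have "A = (\<Prod>z\<in>E. norm (z ^ n))"
    unfolding A_def using prod.reindex_bij_betw[OF bij_E, of norm] by simp
  also have "\<dots> = A ^ n"
    by (simp add: A_def norm_power prod_power_distrib)
  also have "\<dots> = A ^ (n - 1) * A"
    using \<open>n > 0\<close> by (metis power_minus_mult)
  finally have "A ^ (n - 1) = 1" using \<open>A > 0\<close> by simp
  have "norm c ^ card E * C = norm c ^ card E * (\<Prod>z\<in>E. norm (l (z ^ n)))"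
    unfolding C_def using prod.reindex_bij_betw[OF bij_E, of "\<lambda>z. norm (l z)"] by simp
  also have "\<dots> = (\<Prod>z\<in>E. norm (c * l (z ^ n)))"
    by (simp add: norm_mult prod.distrib)
  also have "\<dots> = (\<Prod>z\<in>E. (real n * norm z ^ (n - 1)) ^ d * norm (l z))"
    using step by (intro prod.cong) (auto simp: E_def norm_mult norm_power)
  also have "\<dots> = (\<Prod>z\<in>E. real n * norm z ^ (n - 1)) ^ d * C"
    by (subst prod.distrib) (simp only: prod_power_distrib C_def)
  also have "(\<Prod>z\<in>E. real n * norm z ^ (n - 1)) = real n ^ card E * A ^ (n - 1)"
    by (simp add: prod.distrib prod_power_distrib A_def)
  finally have "norm c ^ card E = (real n ^ d) ^ card E"
    using \<open>C > 0\<close> \<open>A ^ (n - 1) = 1\<close> by (simp add: mult.commute flip: power_mult)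
  moreover have "card E > 0"
    using \<open>finite E\<close> \<open>w \<in> E\<close> by (auto simp: card_gt_0_iff)
  ultimately have "norm c = real n ^ d"
    by (metis norm_ge_zero of_nat_0_le_iff power_eq_imp_eq_base zero_le_power)
  then show ?thesis by (simp add: d_def m_def)
qed

section \<open>Rational eigenfunctions\<close>

lemma rational_function_holomorphic_meromorphic:
  assumes "rational_function f"
  obtains Q where "finite Q" "f holomorphic_on - Q" "f meromorphic_on UNIV"
proof -
  obtain p q where "q \<noteq> 0" and f: "f = (\<lambda>z. poly p z / poly q z)"
    using assms by (auto simp: rational_function_def)
  have an: "poly r analytic_on S" for r :: "complex poly" and S
    by (rule analytic_on_subset[of _ UNIV])
       (auto simp: analytic_on_open field_differentiable_def holomorphic_on_def
             intro: poly_DERIV)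
  show ?thesis
  proof
    show "finite {z. poly q z = 0}" using \<open>q \<noteq> 0\<close> by (simp add: poly_roots_finite)
    show "f holomorphic_on - {z. poly q z = 0}"
      unfolding f by (intro holomorphic_on_divide analytic_imp_holomorphic an) auto
    show "f meromorphic_on UNIV"
      unfolding f by (intro meromorphic_on_divide analytic_on_imp_meromorphic_on an)
  qed
qed

theorem theorem2:
  fixes n :: nat and \<mu> :: complex and F :: "complex fps" and f :: "complex \<Rightarrow> complex"
  assumes "n > 1"
    and "\<mu> \<noteq> 0"
    and "eigenfunction n \<mu> F"
    and "represents f F"
  shows "\<forall>z w. is_pole f z \<and> is_pole f w \<longrightarrow> pole_multiplicity f z = pole_multiplicity f w"
proof -
  have f: "f has_fps_expansion F" and "rational_function f"
    using \<open>represents f F\<close> by (auto simp: represents_def)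
  then obtain Q where Q: "finite Q" "f holomorphic_on - Q" "f meromorphic_on UNIV"
    using rational_function_holomorphic_meromorphic by blast
  have U: "U n F = fps_const \<mu> * F"
    using \<open>eigenfunction n \<mu> F\<close> by (simp add: eigenfunction_def)
  have avg: "\<forall>\<^sub>F x in at a. (\<Sum>\<zeta> | \<zeta> ^ n = 1. f (\<zeta> * x)) = of_nat n * \<mu> * f (x ^ n)" for a
    using root_average_everywhere[OF _ Q(1,2) root_average_near_0[OF _ f U]] \<open>n > 1\<close> by simp
  have "{z. is_pole f z} \<subseteq> Q"
    using not_is_pole_holomorphic[OF _ _ Q(2)] Q(1)
    by (auto simp: finite_imp_closed open_Compl)
  then have fin: "finite {z. is_pole f z}" using Q(1) finite_subset by blast
  have "\<not> is_pole f 0"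
    using f has_fps_expansion_imp_analytic_0 analytic_at_imp_no_pole by blast
  then have "norm (of_nat n * \<mu>) = real n ^ pole_multiplicity f z" if "is_pole f z" for z
    using pole_order_determined[OF _ Q(3) _ avg fin _ that] \<open>n > 1\<close> \<open>\<mu> \<noteq> 0\<close> by simp
  then have "real n ^ pole_multiplicity f z = real n ^ pole_multiplicity f w"
    if "is_pole f z" "is_pole f w" for z w
    using that by metis
  then show ?thesis using \<open>n > 1\<close> by simp
qed

end
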